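(* Let $u(x)$ be smooth in $S_0=I_{0.5}$ and contain a discontinuity in $I_{1.5}$ with jump $\Delta u$. Further, let the optimal weights be $c_0=K_0h^{\gamma_0}$, $c_1=K_1h^{\gamma_1}$, $c_2=1-K_0h^{\gamma_0}-K_1h^{\gamma_1}$ with $K_0,K_1\in\mathbb{R}_{>0}$ and $\gamma_0,\gamma_1\in\mathbb{R}_{\ge0}$. Let $$\omega_i=\frac{\alpha_i}{\alpha_0+\alpha_1+\alpha_2},\qquad \alpha_i=\frac{c_i}{(\epsilon(h)+IS_i)^p},\qquad \epsilon(h)=Kh^q,\qquad i\in\{0,1,2\}.$$ If $pq\ge\gamma_0$, then the weights $\omega_i$ fulfill $$\omega_0=O(1),\qquad \omega_1=O(h^{\gamma_1+pq-\gamma_0}),\qquad \omega_2=O(h^{pq-\gamma_0}).$$ In particular, if the parameters fulfill $pq\ge1+\gamma_0$, then $$\omega_0=O(1),\qquad \omega_1=O(h),\qquad \omega_2=O(h).$$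
   Context: Grid: $h>0$ is the mesh size, $x_0\in\mathbb{R}$ the left boundary point, $x_j=x_0+jh$, and for $j\in\{0.5,1.5,2.5\}$ the cells are $I_j=[x_j-\tfrac h2,x_j+\tfrac h2]$. Cell averages: $\bar u_j=\frac1h\int_{I_j}u(x)\,dx$; differences $\sigma_l=\bar u_{1.5}-\bar u_{0.5}$, $\sigma_r=\bar u_{2.5}-\bar u_{1.5}$. Smoothness indicators: $$IS_0=0,\qquad IS_1=\sigma_l^2,\qquad IS_2=\frac1{c_2^2}\Big(\tfrac43\sigma_r^2+\big(c_1-\tfrac{11}3\big)\sigma_r\sigma_l+\big(\tfrac{10}3-3c_1+c_1^2\big)\sigma_l^2\Big).$$ Parameters: $K\in\mathbb{R}_{>0}$, $q\in\mathbb{R}_{>0}$ and $p\in\mathbb{N}$; the optimal weights satisfy $c_i>0$ and $c_0+c_1+c_2=1$. The case considered is that of a single discontinuity of $u$, located in $I_{1.5}$. The $O(\cdot)$ statements are for $h\to0$.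
   Formalization: The discontinuity in I_{1.5} is assumed to keep distance at least δh (δ>0 fixed) from the right face x_2, since the bound on ω_1 fails for a jump at x_2; the grid origin x_0 may depend on h so that a fixed discontinuity stays in I_{1.5}. *)

theory Defs
  imports "HOL-Analysis.Analysis" "HOL-Library.Landau_Symbols"
begin

definition grid_pt :: "real \<Rightarrow> real \<Rightarrow> real \<Rightarrow> real" where
  "grid_pt x0 h j = x0 + j * h"

definition cell :: "real \<Rightarrow> real \<Rightarrow> real \<Rightarrow> real set" where
  "cell x0 h j = {grid_pt x0 h j - h / 2 .. grid_pt x0 h j + h / 2}"

definition cell_avg :: "(real \<Rightarrow> real) \<Rightarrow> real \<Rightarrow> real \<Rightarrow> real \<Rightarrow> real" where
  "cell_avg u x0 h j = 1 / h * integral (cell x0 h j) u"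

definition sigma_l :: "(real \<Rightarrow> real) \<Rightarrow> real \<Rightarrow> real \<Rightarrow> real" where
  "sigma_l u x0 h = cell_avg u x0 h (3/2) - cell_avg u x0 h (1/2)"

definition sigma_r :: "(real \<Rightarrow> real) \<Rightarrow> real \<Rightarrow> real \<Rightarrow> real" where
  "sigma_r u x0 h = cell_avg u x0 h (5/2) - cell_avg u x0 h (3/2)"

text \<open>In the indexed families below only the indices 0, 1, 2 are meaningful;
  every larger index is treated like 2.\<close>

definition smoothness_ind ::
    "(real \<Rightarrow> real) \<Rightarrow> real \<Rightarrow> real \<Rightarrow> (nat \<Rightarrow> real) \<Rightarrow> nat \<Rightarrow> real" where
  "smoothness_ind u x0 h c i =
     (let sl = sigma_l u x0 h; sr = sigma_r u x0 h in
      if i = 0 then 0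
      else if i = 1 then sl ^ 2
      else 1 / (c 2) ^ 2 *
        (4/3 * sr ^ 2 + (c 1 - 11/3) * sr * sl + (10/3 - 3 * c 1 + (c 1) ^ 2) * sl ^ 2))"

definition opt_weight ::
    "real \<Rightarrow> real \<Rightarrow> real \<Rightarrow> real \<Rightarrow> real \<Rightarrow> nat \<Rightarrow> real" where
  "opt_weight K0 K1 g0 g1 h i =
     (if i = 0 then K0 * h powr g0
      else if i = 1 then K1 * h powr g1
      else 1 - K0 * h powr g0 - K1 * h powr g1)"

definition eps :: "real \<Rightarrow> real \<Rightarrow> real \<Rightarrow> real" where
  "eps K q h = K * h powr q"

definition alpha ::
    "real \<Rightarrow> real \<Rightarrow> nat \<Rightarrow> (real \<Rightarrow> real) \<Rightarrow> real \<Rightarrow> real \<Rightarrow> (nat \<Rightarrow> real) \<Rightarrow> nat \<Rightarrow> real" where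
  "alpha K q p u x0 h c i = c i / (eps K q h + smoothness_ind u x0 h c i) ^ p"

definition omega ::
    "real \<Rightarrow> real \<Rightarrow> nat \<Rightarrow> (real \<Rightarrow> real) \<Rightarrow> real \<Rightarrow> real \<Rightarrow> (nat \<Rightarrow> real) \<Rightarrow> nat \<Rightarrow> real" where
  "omega K q p u x0 h c i =
     alpha K q p u x0 h c i /
     (alpha K q p u x0 h c 0 + alpha K q p u x0 h c 1 + alpha K q p u x0 h c 2)"

text \<open>\<open>C\<^sup>\<infinity>\<close> on a nondegenerate interval, with one-sided derivatives at its endpoints:
  \<open>D n\<close> is the \<open>n\<close>-th derivative of \<open>f\<close> on \<open>S\<close>.\<close>

definition smooth_on :: "real set \<Rightarrow> (real \<Rightarrow> real) \<Rightarrow> bool" where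
  "smooth_on S f \<longleftrightarrow>
     (\<exists>D :: nat \<Rightarrow> real \<Rightarrow> real. (\<forall>x\<in>S. D 0 x = f x) \<and>
        (\<forall>n. \<forall>x\<in>S. (D n has_real_derivative D (Suc n) x) (at x within S)))"

definition has_jump :: "(real \<Rightarrow> real) \<Rightarrow> real \<Rightarrow> real \<Rightarrow> bool" where
  "has_jump u xd J \<longleftrightarrow>
     J \<noteq> 0 \<and>
     (\<exists>ul ur. (u \<longlongrightarrow> ul) (at_left xd) \<and> (u \<longlongrightarrow> ur) (at_right xd) \<and> J = ur - ul)"

text \<open>A fixed \<open>u\<close> cannot have its discontinuity in the second cell for all small \<open>h\<close> if
  the grid is anchored at a fixed point, so the left boundary point \<open>x0 h\<close> depends on
  \<open>h\<close>. The discontinuity is the only one on the three-cell stencil.\<close>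

definition discontinuity_in_second_cell ::
    "(real \<Rightarrow> real) \<Rightarrow> (real \<Rightarrow> real) \<Rightarrow> real \<Rightarrow> real \<Rightarrow> bool" where
  "discontinuity_in_second_cell u x0 xd J \<longleftrightarrow>
     has_jump u xd J \<and>
     (\<forall>\<^sub>F h in at_right 0.
        xd \<in> cell (x0 h) h (3/2) \<and>
        continuous_on
          ((cell (x0 h) h (1/2) \<union> cell (x0 h) h (3/2) \<union> cell (x0 h) h (5/2)) - {xd}) u)"

text \<open>The relative position of \<open>xd\<close> in the second cell stays away from the right face as
  \<open>h\<close> tends to 0. For \<open>xd\<close> on that face, \<open>u\<close> has no jump inside the cell
  and \<open>\<sigma>\<^sub>l\<close> does not see the discontinuity.\<close>

definition away_from_right_face :: "(real \<Rightarrow> real) \<Rightarrow> real \<Rightarrow> bool" where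
  "away_from_right_face x0 xd \<longleftrightarrow>
     (\<exists>\<delta>>0. \<forall>\<^sub>F h in at_right 0. xd \<le> grid_pt (x0 h) h 2 - \<delta> * h)"

end

theory Submission
  imports Defs
begin

text \<open>
  The first substencil has smoothness indicator 0, so
  \<open>\<alpha>\<^sub>0 = c\<^sub>0 / \<epsilon> ^ p\<close> is as large as it can be. The other two indicators stay bounded
  below by a positive constant \<open>m\<close> when the second cell contains a jump, so \<open>\<alpha>\<^sub>1\<close> and
  \<open>\<alpha>\<^sub>2\<close> are at most \<open>c\<^sub>i / m ^ p\<close>. Therefore
  \<open>\<omega>\<^sub>i \<le> \<alpha>\<^sub>i / \<alpha>\<^sub>0 \<le> (c\<^sub>i / c\<^sub>0) (\<epsilon> / m) ^ p\<close>, which is of order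
  \<open>h powr (p q - \<gamma>\<^sub>0)\<close> times the order of \<open>c\<^sub>i\<close> (lemma \<open>omega_le\<close>).

  Two facts give the constant \<open>m\<close>. First, if the discontinuity sits at the fraction
  \<open>\<lambda>\<close> of the second cell, the average there is close to
  \<open>\<lambda> u\<^sub>l + (1 - \<lambda>) u\<^sub>r\<close> and the average over the first cell is close to \<open>u\<^sub>l\<close>.
  Hence \<open>\<sigma>\<^sub>l\<close> is close to \<open>(1 - \<lambda>) \<Delta>u\<close>, and \<open>1 - \<lambda>\<close> is bounded below
  because the discontinuity keeps away from the right face (lemma
  \<open>sigma_l_bounded_away\<close>). Second, the quadratic form in \<open>IS\<^sub>2\<close> has discriminant
  \<open>- 13/3 (1 - c\<^sub>1)\<^sup>2\<close>. So its minimum over \<open>\<sigma>\<^sub>r\<close> is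
  \<open>13/16 (1 - c\<^sub>1)\<^sup>2 \<sigma>\<^sub>l\<^sup>2\<close>, whatever \<open>u\<close> does in the third cell, and since
  \<open>1 - c\<^sub>1 \<ge> c\<^sub>2\<close> the factor \<open>1 / c\<^sub>2\<^sup>2\<close> is absorbed: \<open>IS\<^sub>2\<close> is at least
  \<open>13/16 \<sigma>\<^sub>l\<^sup>2\<close> (lemma \<open>smoothness_ind_2_ge\<close>).
\<close>

section \<open>Cell averages near a jump\<close>

text \<open>Only the open interval is constrained, so that the lemma applies to the pieces of a
  cell on both sides of a discontinuity, with any value of \<open>u\<close> at the discontinuity. It
  also covers an empty piece, when the discontinuity lies on a face.\<close>

lemma integral_near_constant:
  fixes u :: "real \<Rightarrow> real"
  assumes "a \<le> b" and cont: "continuous_on {a<..<b} u"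
    and near: "\<And>x. a < x \<Longrightarrow> x < b \<Longrightarrow> \<bar>u x - l\<bar> \<le> e"
  shows "u integrable_on {a..b}"
    and "\<bar>integral {a..b} u - l * (b - a)\<bar> \<le> e * (b - a)"
proof -
  have "u \<in> borel_measurable (lebesgue_on {a<..<b})"
    by (intro continuous_imp_measurable_on_sets_lebesgue cont) simp
  moreover have "(\<lambda>_::real. \<bar>l\<bar> + e) integrable_on {a<..<b}"
    using integrable_on_open_interval[of "\<lambda>_. \<bar>l\<bar> + e" a b] by (simp add: integrable_const_ivl)
  moreover have "norm (u x) \<le> \<bar>l\<bar> + e" if "x \<in> {a<..<b}" for x
    using near[of x] that by auto
  ultimately have int_open: "u integrable_on {a<..<b}"
    using measurable_bounded_by_integrable_imp_integrable[of u "{a<..<b}" "\<lambda>_. \<bar>l\<bar> + e"]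
    by auto
  then show int: "u integrable_on {a..b}"
    by (simp add: integrable_on_open_interval_real)
  have const: "(\<lambda>_::real. k) integrable_on {a<..<b}" "integral {a<..<b} (\<lambda>_. k) = k * (b - a)"
    for k :: real
    using \<open>a \<le> b\<close> integral_open_interval_real[of a b "\<lambda>_. k"]
    by (auto simp: integrable_on_open_interval_real integrable_const_ivl mult.commute)
  have "norm (integral {a<..<b} (\<lambda>x. u x - l)) \<le> integral {a<..<b} (\<lambda>_. e)"
    by (rule integral_norm_bound_integral)
      (auto intro!: integrable_diff int_open const near)
  then show "\<bar>integral {a..b} u - l * (b - a)\<bar> \<le> e * (b - a)"
    using int_open const integral_diff[OF int_open const(1)[of l]]
    by (simp add: integral_open_interval_real)
qed

lemma sigma_l_bounded_away:
  assumes "discontinuity_in_second_cell u x0 xd J" and "away_from_right_face x0 xd"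
  shows "\<exists>m>0. \<forall>\<^sub>F h in at_right 0. m \<le> \<bar>sigma_l u (x0 h) h\<bar>"
proof -
  obtain ul ur where "J \<noteq> 0" and J: "J = ur - ul"
    and lim_l: "(u \<longlongrightarrow> ul) (at_left xd)" and lim_r: "(u \<longlongrightarrow> ur) (at_right xd)"
    using assms(1) by (auto simp: discontinuity_in_second_cell_def has_jump_def)
  obtain \<delta> where "\<delta> > 0"
    and away: "\<forall>\<^sub>F h in at_right 0. xd \<le> grid_pt (x0 h) h 2 - \<delta> * h"
    using assms(2) by (auto simp: away_from_right_face_def)
  \<comment> \<open>The jump contributes at least \<open>\<delta> \<bar>J\<bar>\<close> to \<open>\<sigma>\<^sub>l\<close>, and each of the two
    averages errs by at most \<open>e\<close>: this leaves half of the contribution.\<close>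
  define e where "e = \<delta> * \<bar>J\<bar> / 4"
  have "e > 0" using \<open>\<delta> > 0\<close> \<open>J \<noteq> 0\<close> by (simp add: e_def)
  obtain d1 where "d1 > 0" and near_l: "\<And>x. x < xd \<Longrightarrow> dist x xd < d1 \<Longrightarrow> dist (u x) ul < e"
    using tendstoD[OF lim_l \<open>e > 0\<close>] by (auto simp: eventually_at)
  obtain d2 where "d2 > 0" and near_r: "\<And>x. x > xd \<Longrightarrow> dist x xd < d2 \<Longrightarrow> dist (u x) ur < e"
    using tendstoD[OF lim_r \<open>e > 0\<close>] by (auto simp: eventually_at)
  have "\<forall>\<^sub>F h in at_right 0. 0 < h \<and> h < min d1 d2 / (2::real)"
    using \<open>d1 > 0\<close> \<open>d2 > 0\<close> by (intro eventually_at_rightI[of 0 "min d1 d2 / 2"]) auto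
  moreover have "\<forall>\<^sub>F h in at_right 0. xd \<in> cell (x0 h) h (3/2) \<and>
        continuous_on
          ((cell (x0 h) h (1/2) \<union> cell (x0 h) h (3/2) \<union> cell (x0 h) h (5/2)) - {xd}) u"
    using assms(1) by (simp add: discontinuity_in_second_cell_def)
  ultimately have "\<forall>\<^sub>F h in at_right 0. \<delta> * \<bar>J\<bar> / 2 \<le> \<bar>sigma_l u (x0 h) h\<bar>"
    using away
  proof eventually_elim
    case (elim h)
    define a b where "a = x0 h + h" and "b = x0 h + 2 * h"
    have h: "0 < h" "2 * h < d1" "2 * h < d2" using elim(1) by auto
    have cells: "cell (x0 h) h (1/2) = {a - h..a}" "cell (x0 h) h (3/2) = {a..b}"
      by (auto simp: cell_def grid_pt_def a_def b_def field_simps)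
    have xd: "a \<le> xd" "xd \<le> b" "\<delta> * h \<le> b - xd" and b: "b = a + h"
      using elim(2,3) cells by (auto simp: grid_pt_def a_def b_def)
    have cont: "continuous_on S u" if "S \<subseteq> {a - h..b} - {xd}" for S
      by (rule continuous_on_subset[OF conjunct2[OF elim(2)]]) (use that cells in auto)
    have left: "\<bar>u x - ul\<bar> \<le> e" if "a - h < x" "x < xd" for x
      using near_l[of x] that xd h b by (simp add: dist_real_def)
    have right: "\<bar>u x - ur\<bar> \<le> e" if "xd < x" "x < b" for x
      using near_r[of x] that xd h b by (simp add: dist_real_def)
    have first: "\<bar>integral {a - h..a} u - ul * (a - (a - h))\<bar> \<le> e * (a - (a - h))"
      by (rule integral_near_constant) (use h xd in \<open>auto intro!: cont left simp: b\<close>)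
    have second_l: "u integrable_on {a..xd}"
        "\<bar>integral {a..xd} u - ul * (xd - a)\<bar> \<le> e * (xd - a)"
      by (rule integral_near_constant[where l = ul and e = e];
          use h xd in \<open>auto intro!: cont left\<close>)+
    have second_r: "u integrable_on {xd..b}"
        "\<bar>integral {xd..b} u - ur * (b - xd)\<bar> \<le> e * (b - xd)"
      by (rule integral_near_constant[where l = ur and e = e];
          use h xd in \<open>auto intro!: cont right\<close>)+
    have "u integrable_on {a..b}"
      using Henstock_Kurzweil_Integration.integrable_combine[OF xd(1,2)] second_l(1) second_r(1) by blast
    then have split: "integral {a..b} u = integral {a..xd} u + integral {xd..b} u"
      using Henstock_Kurzweil_Integration.integral_combine[OF xd(1,2), of u] by simp
    have sl: "h * sigma_l u (x0 h) h = integral {a..b} u - integral {a - h..a} u"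
      using h by (simp add: sigma_l_def cell_avg_def cells field_simps)
    have "h * sigma_l u (x0 h) h - J * (b - xd) =
        (integral {a..xd} u - ul * (xd - a)) + (integral {xd..b} u - ur * (b - xd))
        - (integral {a - h..a} u - ul * (a - (a - h)))"
      unfolding sl split J by (simp add: b algebra_simps)
    moreover have "2 * e * h = e * (xd - a) + e * (b - xd) + e * (a - (a - h))"
      by (simp add: b algebra_simps)
    ultimately have "\<bar>h * sigma_l u (x0 h) h - J * (b - xd)\<bar> \<le> 2 * e * h"
      using first second_l(2) second_r(2) by linarith
    moreover have "\<bar>J\<bar> * (\<delta> * h) \<le> \<bar>J * (b - xd)\<bar>"
      using xd by (simp add: abs_mult mult_left_mono)
    moreover have "2 * e * h = \<delta> * \<bar>J\<bar> / 2 * h" "\<bar>J\<bar> * (\<delta> * h) = 2 * (\<delta> * \<bar>J\<bar> / 2 * h)"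
      by (simp_all add: e_def)
    ultimately have "\<delta> * \<bar>J\<bar> / 2 * h \<le> \<bar>h * sigma_l u (x0 h) h\<bar>"
      by linarith
    then show ?case
      using h by (simp add: abs_mult mult.commute)
  qed
  moreover have "\<delta> * \<bar>J\<bar> / 2 > 0" using \<open>\<delta> > 0\<close> \<open>J \<noteq> 0\<close> by simp
  ultimately show ?thesis by blast
qed

section \<open>Lower bound for the second smoothness indicator\<close>

text \<open>Completing the square in \<open>\<sigma>\<^sub>r\<close> makes the lower bound independent of the data in
  the third cell.\<close>

lemma smoothness_ind_2_ge:
  assumes "0 < c 2" and "c 2 \<le> 1 - c 1"
  shows "13/16 * (sigma_l u x0 h)\<^sup>2 \<le> smoothness_ind u x0 h c 2"
proof -
  let ?sl = "sigma_l u x0 h" and ?sr = "sigma_r u x0 h"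
  let ?Q = "4/3 * ?sr ^ 2 + (c 1 - 11/3) * ?sr * ?sl + (10/3 - 3 * c 1 + (c 1) ^ 2) * ?sl ^ 2"
  have "?Q = 4/3 * (?sr + 3/8 * (c 1 - 11/3) * ?sl)\<^sup>2 + 13/16 * ((1 - c 1)\<^sup>2 * ?sl\<^sup>2)"
    by (simp add: power2_eq_square field_simps)
  moreover have "(c 2)\<^sup>2 * ?sl\<^sup>2 \<le> (1 - c 1)\<^sup>2 * ?sl\<^sup>2"
    using assms by (intro mult_right_mono power_mono) auto
  moreover have "0 \<le> (?sr + 3/8 * (c 1 - 11/3) * ?sl)\<^sup>2" by simp
  ultimately have "(c 2)\<^sup>2 * (13/16 * ?sl\<^sup>2) \<le> ?Q"
    by linarith
  then have "13/16 * ?sl\<^sup>2 \<le> ?Q / (c 2)\<^sup>2"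
    using assms(1) by (simp only: pos_le_divide_eq zero_less_power mult.commute)
  then show ?thesis
    by (simp add: smoothness_ind_def Let_def)
qed

lemma smoothness_ind_nonneg:
  assumes "0 < c 2" and "c 2 \<le> 1 - c 1"
  shows "0 \<le> smoothness_ind u x0 h c i"
proof -
  have "0 \<le> smoothness_ind u x0 h c 2"
    using smoothness_ind_2_ge[OF assms, of u x0 h] zero_le_power2[of "sigma_l u x0 h"] by linarith
  then show ?thesis by (simp add: smoothness_ind_def Let_def)
qed

section \<open>Order of magnitude of the weights\<close>

lemma alpha_pos:
  assumes "0 < c i" and "0 < c 2" and "c 2 \<le> 1 - c 1" and "0 < eps K q h"
  shows "0 < alpha K q p u x0 h c i"
  using assms smoothness_ind_nonneg[of c u x0 h i] by (simp add: alpha_def add_pos_nonneg)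

text \<open>The denominator of \<open>\<omega>\<^sub>i\<close> is bounded below by its term \<open>\<alpha>\<^sub>0\<close> alone. While
  \<open>\<epsilon> ^ p / c\<^sub>0\<close> stays bounded, which is the case \<open>p q \<ge> \<gamma>\<^sub>0\<close>, this loses only a
  constant factor.\<close>

lemma omega_le:
  assumes pos: "\<And>j. j \<in> {0, 1, 2} \<Longrightarrow> 0 < c j" and "c 2 \<le> 1 - c 1" and eps: "0 < eps K q h"
    and i: "i \<in> {0, 1, 2}" and "0 < m" and m: "m \<le> smoothness_ind u x0 h c i"
  shows "omega K q p u x0 h c i \<le> c i / c 0 * (eps K q h / m) ^ p"
proof -
  let ?\<alpha> = "alpha K q p u x0 h c"
  have \<alpha>: "0 < ?\<alpha> j" if "j \<in> {0, 1, 2}" for j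
    using alpha_pos[OF pos[OF that] pos[of 2] assms(2) eps] by simp
  have "omega K q p u x0 h c i \<le> ?\<alpha> i / ?\<alpha> 0"
    unfolding omega_def using \<alpha>[OF i] \<alpha>[of 0] \<alpha>[of 1] \<alpha>[of 2] by (intro divide_left_mono) auto
  also have "\<dots> \<le> (c i / m ^ p) / ?\<alpha> 0"
    using \<open>0 < m\<close> m eps pos[OF i] \<alpha>[of 0]
    by (intro divide_right_mono, unfold alpha_def, intro divide_left_mono power_mono) auto
  also have "\<dots> = c i / c 0 * (eps K q h / m) ^ p"
    by (simp add: alpha_def smoothness_ind_def power_divide)
  finally show ?thesis .
qed

lemma omega_bounds:
  assumes pos: "\<And>j. j \<in> {0, 1, 2} \<Longrightarrow> 0 < c j" and "c 2 \<le> 1 - c 1" and eps: "0 < eps K q h"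
    and i: "i \<in> {0, 1, 2}"
  shows "0 \<le> omega K q p u x0 h c i" and "omega K q p u x0 h c i \<le> 1"
proof -
  have "0 < alpha K q p u x0 h c j" if "j \<in> {0, 1, 2}" for j
    using alpha_pos[OF pos[OF that] pos[of 2] assms(2) eps] by simp
  from this[of 0] this[of 1] this[of 2] i
  show "0 \<le> omega K q p u x0 h c i" "omega K q p u x0 h c i \<le> 1"
    by (auto simp: omega_def divide_simps)
qed

text \<open>The factor \<open>C h powr g\<close> stands for the size of the weight \<open>c\<^sub>i\<close>: the exponent is
  \<open>g = \<gamma>\<^sub>1\<close> for \<open>i = 1\<close> and \<open>g = 0\<close> for \<open>i = 2\<close>.\<close>

lemma omega_bigo:
  fixes x0 :: "real \<Rightarrow> real" and c :: "real \<Rightarrow> nat \<Rightarrow> real"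
  assumes "0 < K" and "0 < K0" and i: "i \<in> {0, 1, 2}" and "0 < m"
    and pos: "\<forall>\<^sub>F h in at_right 0. \<forall>j\<in>{0, 1, 2}. 0 < c h j"
    and sum_c: "\<forall>\<^sub>F h in at_right 0. c h 2 \<le> 1 - c h 1"
    and c0: "\<And>h. c h 0 = K0 * h powr g0"
    and ci: "\<forall>\<^sub>F h in at_right 0. c h i \<le> C * h powr g"
    and m: "\<forall>\<^sub>F h in at_right 0. m \<le> smoothness_ind u (x0 h) h (c h) i"
  shows "(\<lambda>h. omega K q p u (x0 h) h (c h) i) \<in> O[at_right 0](\<lambda>h. h powr (g + real p * q - g0))"
proof (rule bigoI)
  have "\<forall>\<^sub>F h in at_right (0::real). 0 < h"
    by (simp add: eventually_at_right_less)
  with pos sum_c ci m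
  show "\<forall>\<^sub>F h in at_right 0. norm (omega K q p u (x0 h) h (c h) i)
      \<le> C / K0 * (K / m) ^ p * norm (h powr (g + real p * q - g0))"
  proof eventually_elim
    case (elim h)
    have eps: "0 < eps K q h" using \<open>0 < K\<close> elim by (simp add: eps_def)
    have pos_h: "\<And>j. j \<in> {0, 1, 2} \<Longrightarrow> 0 < c h j" using elim by blast
    have "omega K q p u (x0 h) h (c h) i \<le> c h i / c h 0 * (eps K q h / m) ^ p"
      using elim \<open>0 < m\<close> by (intro omega_le pos_h eps i) auto
    also have "\<dots> \<le> (C * h powr g) / c h 0 * (eps K q h / m) ^ p"
      using elim pos_h[of 0] \<open>0 < m\<close> eps by (intro mult_right_mono divide_right_mono) auto
    also have "\<dots> = C / K0 * (K / m) ^ p * h powr (g + real p * q - g0)"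
      using elim
      by (simp add: c0 eps_def powr_add powr_diff powr_power power_divide power_mult_distrib
          field_simps)
    finally show ?case
      using omega_bounds(1)[where c = "c h", OF pos_h _ eps i] elim by simp
  qed
qed

lemma powr_bigo_id_at_right_0:
  assumes "1 \<le> s"
  shows "(\<lambda>h::real. h powr s) \<in> O[at_right 0](\<lambda>h. h)"
proof (rule bigoI)
  have "\<forall>\<^sub>F h::real in at_right 0. 0 < h \<and> h < 1"
    by (intro eventually_at_rightI[of 0 1]) auto
  then show "\<forall>\<^sub>F h::real in at_right 0. norm (h powr s) \<le> 1 * norm h"
    by eventually_elim (use assms powr_mono'[of 1 s] in auto)
qed

theorem theorem3p3:
  fixes u x0 :: "real \<Rightarrow> real" and xd \<Delta>u :: real
    and K q K0 K1 \<gamma>0 \<gamma>1 :: real and p :: nat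
    and c \<omega> :: "real \<Rightarrow> nat \<Rightarrow> real"
  defines "c \<equiv> opt_weight K0 K1 \<gamma>0 \<gamma>1"
    and "\<omega> \<equiv> (\<lambda>h. omega K q p u (x0 h) h (c h))"
  assumes "K > 0" and "q > 0" and "K0 > 0" and "K1 > 0" and "\<gamma>0 \<ge> 0" and "\<gamma>1 \<ge> 0"
    and weights_pos: "\<forall>\<^sub>F h in at_right 0. \<forall>i\<in>{0, 1, 2}. c h i > 0"
    and smooth: "\<forall>\<^sub>F h in at_right 0. smooth_on (cell (x0 h) h (1/2)) u"
    and jump: "discontinuity_in_second_cell u x0 xd \<Delta>u"
    and interior: "away_from_right_face x0 xd"
  shows "(real p * q \<ge> \<gamma>0 \<longrightarrow>
            (\<lambda>h. \<omega> h 0) \<in> O[at_right 0](\<lambda>_. 1) \<and>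
            (\<lambda>h. \<omega> h 1) \<in> O[at_right 0](\<lambda>h. h powr (\<gamma>1 + real p * q - \<gamma>0)) \<and>
            (\<lambda>h. \<omega> h 2) \<in> O[at_right 0](\<lambda>h. h powr (real p * q - \<gamma>0))) \<and>
         (real p * q \<ge> 1 + \<gamma>0 \<longrightarrow>
            (\<lambda>h. \<omega> h 0) \<in> O[at_right 0](\<lambda>_. 1) \<and>
            (\<lambda>h. \<omega> h 1) \<in> O[at_right 0](\<lambda>h. h) \<and>
            (\<lambda>h. \<omega> h 2) \<in> O[at_right 0](\<lambda>h. h))"
proof -
  have pos: "\<forall>\<^sub>F h in at_right 0. \<forall>j\<in>{0, 1, 2}. 0 < c h j"
    using weights_pos .
  then have sum_c: "\<forall>\<^sub>F h in at_right 0. c h 2 \<le> 1 - c h 1"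
    by eventually_elim (simp add: c_def opt_weight_def)
  obtain s where "0 < s" and s: "\<forall>\<^sub>F h in at_right 0. s \<le> \<bar>sigma_l u (x0 h) h\<bar>"
    using sigma_l_bounded_away[OF jump interior] by blast
  then have sq: "\<forall>\<^sub>F h in at_right 0. s\<^sup>2 \<le> (sigma_l u (x0 h) h)\<^sup>2"
    by (auto elim!: eventually_mono simp: abs_le_square_iff[symmetric])
  have IS1: "\<forall>\<^sub>F h in at_right 0. s\<^sup>2 \<le> smoothness_ind u (x0 h) h (c h) 1"
    using sq by (simp add: smoothness_ind_def Let_def)
  have IS2: "\<forall>\<^sub>F h in at_right 0. 13/16 * s\<^sup>2 \<le> smoothness_ind u (x0 h) h (c h) 2"
    using sq pos sum_c
  proof eventually_elim
    case (elim h)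
    then show ?case
      using smoothness_ind_2_ge[of "c h" u "x0 h" h] by simp
  qed
  have \<omega>0: "(\<lambda>h. \<omega> h 0) \<in> O[at_right 0](\<lambda>_. 1)"
  proof (rule bigoI)
    have "\<forall>\<^sub>F h in at_right (0::real). 0 < h"
      by (simp add: eventually_at_right_less)
    with pos sum_c show "\<forall>\<^sub>F h in at_right 0. norm (\<omega> h 0) \<le> 1 * norm (1::real)"
    proof eventually_elim
      case (elim h)
      have "0 < eps K q h" using \<open>K > 0\<close> elim by (simp add: eps_def)
      then have "0 \<le> \<omega> h 0" "\<omega> h 0 \<le> 1"
        unfolding \<omega>_def using elim by (intro omega_bounds; blast)+
      then show ?case by simp
    qed
  qed
  have \<omega>1: "(\<lambda>h. \<omega> h 1) \<in> O[at_right 0](\<lambda>h. h powr (\<gamma>1 + real p * q - \<gamma>0))"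
    unfolding \<omega>_def
    by (rule omega_bigo[OF \<open>K > 0\<close> \<open>K0 > 0\<close> _ _ pos sum_c _ _ IS1, where C = K1])
      (use \<open>0 < s\<close> in \<open>auto simp: c_def opt_weight_def\<close>)
  have "\<forall>\<^sub>F h in at_right (0::real). 0 < h"
    by (simp add: eventually_at_right_less)
  with pos sum_c have c2: "\<forall>\<^sub>F h in at_right 0. c h 2 \<le> 1 * h powr 0"
    by eventually_elim auto
  have "(\<lambda>h. \<omega> h 2) \<in> O[at_right 0](\<lambda>h. h powr (0 + real p * q - \<gamma>0))"
    unfolding \<omega>_def
    by (rule omega_bigo[OF \<open>K > 0\<close> \<open>K0 > 0\<close> _ _ pos sum_c _ c2 IS2])
      (use \<open>0 < s\<close> in \<open>auto simp: c_def opt_weight_def\<close>)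
  then have \<omega>2: "(\<lambda>h. \<omega> h 2) \<in> O[at_right 0](\<lambda>h. h powr (real p * q - \<gamma>0))"
    by simp
  have "(\<lambda>h. \<omega> h 1) \<in> O[at_right 0](\<lambda>h. h)" "(\<lambda>h. \<omega> h 2) \<in> O[at_right 0](\<lambda>h. h)"
    if "real p * q \<ge> 1 + \<gamma>0"
    by (rule landau_o.big_trans[OF \<omega>1] landau_o.big_trans[OF \<omega>2];
        rule powr_bigo_id_at_right_0; use that \<open>\<gamma>1 \<ge> 0\<close> in simp)+
  with \<omega>0 \<omega>1 \<omega>2 show ?thesis by blast
qed

end
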